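(* Let $G$ be a connected finite simple graph of order $n$. Then $\iota(\mathrm{Mid}(G))\le \lfloor \frac{n}{2}\rfloor$, and equality holds if and only if: when $n$ is even, $G\cong K_n$ or $G\cong K_{n/2,n/2}$; and when $n$ is odd, every maximal matching of $G$ is near-perfect.
   Context: For a graph $H$ and $S\subseteq V(H)$, let $N_H[S]$ be $S$ together with all vertices adjacent to a vertex of $S$. A set $S\subseteq V(H)$ is an isolating set of $H$ if $V(H)\setminus N_H[S]$ is an independent set of $H$; $\iota(H)$ is the minimum size of an isolating set of $H$. The middle graph $\mathrm{Mid}(G)$ has vertex set $V(G)\cup\{m_e: e\in E(G)\}$, with $v\sim m_e$ iff $v$ is an endpoint of $e$, $m_e\sim m_f$ iff distinct edges $e,f$ share an endpoint, and no edges between vertices of $V(G)$. A near-perfect matching of $G$ is a matching that leaves exactly one vertex of $G$ unmatched. *)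

theory Defs
  imports Main
begin

record 'a ugraph =
  verts :: "'a set"
  edges :: "'a set set"

definition finite_simple_graph :: "'a ugraph \<Rightarrow> bool" where
  "finite_simple_graph G \<longleftrightarrow>
     finite (verts G) \<and> (\<forall>e\<in>edges G. e \<subseteq> verts G \<and> card e = 2)"

definition adj :: "'a ugraph \<Rightarrow> 'a \<Rightarrow> 'a \<Rightarrow> bool" where
  "adj G u v \<longleftrightarrow> {u, v} \<in> edges G"

text \<open>The graph without vertices is, as usual, not connected.\<close>

definition connected_graph :: "'a ugraph \<Rightarrow> bool" where
  "connected_graph G \<longleftrightarrow>
     verts G \<noteq> {} \<and> (\<forall>u\<in>verts G. \<forall>v\<in>verts G. (adj G)\<^sup>*\<^sup>* u v)"

definition graph_iso :: "'a ugraph \<Rightarrow> 'b ugraph \<Rightarrow> bool" where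
  "graph_iso G H \<longleftrightarrow>
     (\<exists>f. bij_betw f (verts G) (verts H) \<and>
          (\<forall>u\<in>verts G. \<forall>v\<in>verts G. adj G u v \<longleftrightarrow> adj H (f u) (f v)))"

definition complete_graph :: "nat \<Rightarrow> nat ugraph" where
  "complete_graph n =
     \<lparr>verts = {..<n}, edges = {{i, j} | i j. i < n \<and> j < n \<and> i \<noteq> j}\<rparr>"

definition complete_bipartite_graph :: "nat \<Rightarrow> nat \<Rightarrow> (nat + nat) ugraph" where
  "complete_bipartite_graph m n =
     \<lparr>verts = {..<m} <+> {..<n}, edges = {{Inl i, Inr j} | i j. i < m \<and> j < n}\<rparr>"

definition closed_nbhd :: "'a ugraph \<Rightarrow> 'a set \<Rightarrow> 'a set" where
  "closed_nbhd H S = S \<union> {v \<in> verts H. \<exists>s\<in>S. adj H s v}"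

definition independent_set :: "'a ugraph \<Rightarrow> 'a set \<Rightarrow> bool" where
  "independent_set H I \<longleftrightarrow> I \<subseteq> verts H \<and> (\<forall>u\<in>I. \<forall>v\<in>I. \<not> adj H u v)"

definition isolating_set :: "'a ugraph \<Rightarrow> 'a set \<Rightarrow> bool" where
  "isolating_set H S \<longleftrightarrow>
     S \<subseteq> verts H \<and> independent_set H (verts H - closed_nbhd H S)"

text \<open>Meaningful for finite graphs, where the minimum is over a finite nonempty set:
  the full vertex set is always isolating.\<close>

definition isolation_number :: "'a ugraph \<Rightarrow> nat" where
  "isolation_number H = Min (card ` {S. isolating_set H S})"

text \<open>\<open>Inl v\<close> is the original vertex \<open>v\<close>, and \<open>Inr e\<close> is the new vertex \<open>m\<^sub>e\<close>.\<close>

definition middle_graph :: "'a ugraph \<Rightarrow> ('a + 'a set) ugraph" where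
  "middle_graph G =
     \<lparr>verts = verts G <+> edges G,
      edges = {{Inl v, Inr e} | v e. e \<in> edges G \<and> v \<in> e} \<union>
              {{Inr e, Inr f} | e f. e \<in> edges G \<and> f \<in> edges G \<and> e \<noteq> f \<and> e \<inter> f \<noteq> {}}\<rparr>"

definition matching :: "'a ugraph \<Rightarrow> 'a set set \<Rightarrow> bool" where
  "matching G M \<longleftrightarrow> M \<subseteq> edges G \<and> pairwise disjnt M"

definition maximal_matching :: "'a ugraph \<Rightarrow> 'a set set \<Rightarrow> bool" where
  "maximal_matching G M \<longleftrightarrow> matching G M \<and> (\<nexists>M'. matching G M' \<and> M \<subset> M')"

definition near_perfect_matching :: "'a ugraph \<Rightarrow> 'a set set \<Rightarrow> bool" where
  "near_perfect_matching G M \<longleftrightarrow> matching G M \<and> card (verts G - \<Union>M) = 1"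

lemma adj_middle_graph:
  "\<not> adj (middle_graph G) (Inl u) (Inl v)"
  "adj (middle_graph G) (Inl v) (Inr e) \<longleftrightarrow> e \<in> edges G \<and> v \<in> e"
  "adj (middle_graph G) (Inr e) (Inl v) \<longleftrightarrow> e \<in> edges G \<and> v \<in> e"
  "adj (middle_graph G) (Inr e) (Inr f) \<longleftrightarrow>
     e \<in> edges G \<and> f \<in> edges G \<and> e \<noteq> f \<and> e \<inter> f \<noteq> {}"
  by (auto simp: adj_def middle_graph_def doubleton_eq_iff)

lemma finite_simple_middle_graph:
  assumes "finite_simple_graph G"
  shows "finite_simple_graph (middle_graph G)"
proof -
  have "edges G \<subseteq> Pow (verts G)"
    using assms by (auto simp: finite_simple_graph_def)
  then have "finite (edges G)"
    using assms by (meson finite_Pow_iff finite_simple_graph_def finite_subset)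
  then show ?thesis
    using assms by (auto simp: finite_simple_graph_def middle_graph_def card_insert_if)
qed

end

theory Submission
  imports Defs
begin

text \<open>
  A set \<open>S = A \<union> {m\<^sub>e : e \<in> F}\<close> isolates the middle graph of \<open>G\<close> iff \<open>A \<union> \<Union>F\<close> is a vertex cover of \<open>G\<close>.
  Replacing each vertex of \<open>A\<close> by an incident edge and then exchanging edges turns \<open>S\<close> into a maximal
  matching that is no larger, so the isolation number is the minimum size of a maximal matching
  of \<open>G\<close>. Hence it is at most \<open>n div 2\<close>, with equality iff every maximal matching has \<open>n div 2\<close> edges.

  For even \<open>n\<close> this says that every maximal matching is perfect. Fix a perfect matching with partner
  map \<open>p\<close>. Exchanging along alternating paths with two or three matching edges shows that between
  any two matching edges there are exactly two disjoint or all four cross edges, that one pair with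
  four cross edges forces \<open>G\<close> to be complete, and that otherwise the neighbourhood of any vertex is
  one side of a balanced complete bipartition.
\<close>

section \<open>Elementary facts on adjacency and edges\<close>

lemma adj_sym: "adj G u v \<Longrightarrow> adj G v u"
  by (simp add: adj_def insert_commute)

lemma adj_irrefl: "finite_simple_graph G \<Longrightarrow> \<not> adj G v v"
  by (auto simp: adj_def finite_simple_graph_def)

lemma adj_verts: "finite_simple_graph G \<Longrightarrow> adj G u v \<Longrightarrow> u \<in> verts G \<and> v \<in> verts G"
  by (auto simp: adj_def finite_simple_graph_def)

lemma edge_verts: "finite_simple_graph G \<Longrightarrow> e \<in> edges G \<Longrightarrow> e \<subseteq> verts G"
  by (auto simp: finite_simple_graph_def)

lemma edge_endpoints:
  assumes "finite_simple_graph G" "e \<in> edges G"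
  obtains u v where "e = {u, v}" "u \<noteq> v" "adj G u v"
proof -
  have "card e = 2" using assms by (simp add: finite_simple_graph_def)
  then obtain u v where "e = {u, v}" "u \<noteq> v" by (auto simp: card_2_iff)
  with assms that show thesis by (auto simp: adj_def)
qed

lemma finite_edges: "finite_simple_graph G \<Longrightarrow> finite (edges G)"
  by (rule finite_subset[of _ "Pow (verts G)"]) (auto simp: finite_simple_graph_def)

section \<open>Isolating sets of the middle graph as vertex covers\<close>

text \<open>Call a vertex covered if it is chosen itself or lies on a chosen edge. Then
  \<open>Inl v\<close> avoids the closed neighbourhood of \<open>S\<close> iff \<open>v\<close> is
  uncovered, and \<open>Inr e\<close> avoids it iff both ends of \<open>e\<close> are
  uncovered.\<close>

lemma isolating_set_middle_graph_iff:
  assumes G: "finite_simple_graph G"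
  shows "isolating_set (middle_graph G) S \<longleftrightarrow>
    S \<subseteq> verts G <+> edges G \<and>
    independent_set G (verts G - (Inl -` S \<union> \<Union>(Inr -` S)))"
proof (cases "S \<subseteq> verts G <+> edges G")
  case S: True
  let ?W = "verts G - (Inl -` S \<union> \<Union>(Inr -` S))"
  let ?U = "verts (middle_graph G) - closed_nbhd (middle_graph G) S"
  have Inl_U: "Inl v \<in> ?U \<longleftrightarrow> v \<in> ?W" for v
  proof -
    have "(\<exists>s\<in>S. adj (middle_graph G) s (Inl v)) \<longleftrightarrow> v \<in> \<Union>(Inr -` S)"
    proof
      assume "\<exists>s\<in>S. adj (middle_graph G) s (Inl v)"
      then obtain s where "s \<in> S" "adj (middle_graph G) s (Inl v)" by blast
      then show "v \<in> \<Union>(Inr -` S)" by (cases s) (auto simp: adj_middle_graph)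
    next
      assume "v \<in> \<Union>(Inr -` S)"
      then obtain e where "Inr e \<in> S" "v \<in> e" by auto
      then show "\<exists>s\<in>S. adj (middle_graph G) s (Inl v)"
        using S by (intro bexI[of _ "Inr e"]) (auto simp: adj_middle_graph)
    qed
    then show ?thesis by (auto simp: closed_nbhd_def middle_graph_def)
  qed
  have Inr_U: "Inr e \<in> ?U \<longleftrightarrow> e \<in> edges G \<and> e \<subseteq> ?W" for e
  proof (cases "e \<in> edges G")
    case True
    then obtain a b where ab: "e = {a, b}" using edge_endpoints[OF G] by metis
    have "Inr e \<in> S \<or> (\<exists>s\<in>S. adj (middle_graph G) s (Inr e)) \<longleftrightarrow>
        e \<inter> (Inl -` S \<union> \<Union>(Inr -` S)) \<noteq> {}"
    proof
      assume "Inr e \<in> S \<or> (\<exists>s\<in>S. adj (middle_graph G) s (Inr e))"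
      then show "e \<inter> (Inl -` S \<union> \<Union>(Inr -` S)) \<noteq> {}"
      proof
        assume "Inr e \<in> S"
        then show ?thesis using ab by auto
      next
        assume "\<exists>s\<in>S. adj (middle_graph G) s (Inr e)"
        then obtain s where "s \<in> S" "adj (middle_graph G) s (Inr e)" by blast
        then show ?thesis by (cases s) (auto simp: adj_middle_graph)
      qed
    next
      assume "e \<inter> (Inl -` S \<union> \<Union>(Inr -` S)) \<noteq> {}"
      then consider v where "v \<in> e" "Inl v \<in> S" | v f where "v \<in> e" "v \<in> f" "Inr f \<in> S" by auto
      then show "Inr e \<in> S \<or> (\<exists>s\<in>S. adj (middle_graph G) s (Inr e))"
      proof cases
        case 1
        then have "adj (middle_graph G) (Inl v) (Inr e)" using True by (simp add: adj_middle_graph)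
        with 1 show ?thesis by blast
      next
        case 2
        then have "f = e \<or> adj (middle_graph G) (Inr f) (Inr e)"
          using True S by (auto simp: adj_middle_graph)
        with 2 show ?thesis by blast
      qed
    qed
    then show ?thesis using True edge_verts[OF G True] by (auto simp: closed_nbhd_def middle_graph_def)
  qed (auto simp: middle_graph_def)
  have "independent_set (middle_graph G) ?U \<longleftrightarrow> independent_set G ?W"
  proof
    assume ind: "independent_set (middle_graph G) ?U"
    have "\<not> adj G u v" if uv: "u \<in> ?W" "v \<in> ?W" for u v
    proof
      assume "adj G u v"
      \<comment> \<open>An edge with both ends uncovered leaves its middle vertex undominated, next
        to the undominated \<open>Inl u\<close>.\<close>
      then have "Inr {u, v} \<in> ?U" "adj (middle_graph G) (Inl u) (Inr {u, v})"
        using uv Inr_U[of "{u, v}"] by (auto simp: adj_def[of G] adj_middle_graph)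
      then show False using ind Inl_U[of u] uv by (auto simp: independent_set_def)
    qed
    then show "independent_set G ?W" by (auto simp: independent_set_def)
  next
    assume ind: "independent_set G ?W"
    \<comment> \<open>Without uncovered edges only original vertices survive, and these are pairwise
      nonadjacent in the middle graph.\<close>
    have no: "Inr e \<notin> ?U" for e
    proof
      assume "Inr e \<in> ?U"
      then have "e \<in> edges G" "e \<subseteq> ?W" using Inr_U by auto
      then show False using edge_endpoints[OF G] ind
        by (metis independent_set_def insert_subset)
    qed
    have "\<not> adj (middle_graph G) x y" if "x \<in> ?U" "y \<in> ?U" for x y
      using that no by (cases x; cases y) (auto simp: adj_middle_graph)
    then show "independent_set (middle_graph G) ?U" by (auto simp: independent_set_def)
  qed
  then show ?thesis using S by (simp add: isolating_set_def middle_graph_def)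
qed (simp add: isolating_set_def middle_graph_def)

lemma isolation_number_le:
  assumes "finite (verts H)" "isolating_set H S"
  shows "isolation_number H \<le> card S"
proof -
  have "finite {S. isolating_set H S}"
    by (rule finite_subset[of _ "Pow (verts H)"]) (auto simp: isolating_set_def assms(1))
  then show ?thesis using assms(2) by (auto simp: isolation_number_def intro!: Min_le)
qed

lemma isolation_number_attained:
  assumes "finite (verts H)"
  obtains S where "isolating_set H S" "card S = isolation_number H"
proof -
  have fin: "finite {S. isolating_set H S}"
    by (rule finite_subset[of _ "Pow (verts H)"]) (auto simp: isolating_set_def assms)
  have "isolating_set H (verts H)"
    by (auto simp: isolating_set_def independent_set_def closed_nbhd_def)
  then have "isolation_number H \<in> card ` {S. isolating_set H S}"
    unfolding isolation_number_def using fin by (intro Min_in) auto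
  then show thesis using that by auto
qed

section \<open>Maximal matchings and edge exchanges\<close>

text \<open>An edge between two unmatched vertices could be added to \<open>M\<close>. Conversely,
  an additional edge of a larger matching is disjoint from every edge of \<open>M\<close>, so both
  its ends are unmatched.\<close>

lemma maximal_matching_iff:
  assumes G: "finite_simple_graph G"
  shows "maximal_matching G M \<longleftrightarrow> matching G M \<and> independent_set G (verts G - \<Union>M)"
proof safe
  assume M: "maximal_matching G M"
  then show "matching G M" by (simp add: maximal_matching_def)
  have "\<not> adj G u v" if "u \<notin> \<Union>M" "v \<notin> \<Union>M" for u v
  proof
    assume "adj G u v"
    then have "matching G (insert {u, v} M)" "{u, v} \<notin> M"
      using M that by (auto simp: maximal_matching_def matching_def adj_def pairwise_insert disjnt_def)
    then show False using M by (auto simp: maximal_matching_def)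
  qed
  then show "independent_set G (verts G - \<Union>M)" by (auto simp: independent_set_def)
next
  assume M: "matching G M" and ind: "independent_set G (verts G - \<Union>M)"
  have False if M': "matching G M'" "M \<subset> M'" for M'
  proof -
    from M' obtain e where e: "e \<in> M'" "e \<notin> M" by blast
    then have eE: "e \<in> edges G" using M' by (auto simp: matching_def)
    then obtain u v where uv: "e = {u, v}" "adj G u v" using edge_endpoints[OF G] by metis
    have "e \<inter> \<Union>M = {}"
      using M' e by (fastforce simp: matching_def pairwise_def disjnt_def)
    then show False using ind uv edge_verts[OF G eE] by (auto simp: independent_set_def)
  qed
  with M show "maximal_matching G M" by (auto simp: maximal_matching_def)
qed

lemma card_Union_matching:
  assumes G: "finite_simple_graph G" and M: "matching G M"
  shows "card (\<Union>M) = 2 * card M"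
proof -
  have "card (\<Union>M) = (\<Sum>e\<in>M. card e)"
  proof (rule card_Union_disjoint)
    show "pairwise disjnt M" using M by (simp add: matching_def)
    show "finite e" if "e \<in> M" for e
      using that M G by (auto simp: matching_def finite_simple_graph_def intro: finite_subset)
  qed
  also have "\<dots> = (\<Sum>e\<in>M. 2)"
    using M G by (intro sum.cong) (auto simp: matching_def finite_simple_graph_def)
  finally show ?thesis by simp
qed

lemma Union_matching_subset: "finite_simple_graph G \<Longrightarrow> matching G M \<Longrightarrow> \<Union>M \<subseteq> verts G"
  by (auto simp: matching_def dest: edge_verts)

lemma card_unmatched:
  assumes "finite_simple_graph G" "matching G M"
  shows "card (verts G - \<Union>M) = card (verts G) - 2 * card M" "2 * card M \<le> card (verts G)"
proof -
  have *: "\<Union>M \<subseteq> verts G" "finite (verts G)"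
    using assms Union_matching_subset by (auto simp: finite_simple_graph_def)
  then show "card (verts G - \<Union>M) = card (verts G) - 2 * card M"
    using assms card_Union_matching by (metis card_Diff_subset finite_subset)
  show "2 * card M \<le> card (verts G)"
    using * assms card_Union_matching by (metis card_mono)
qed

lemma matching_extends_to_maximal:
  assumes G: "finite_simple_graph G" and M: "matching G M"
  obtains M' where "maximal_matching G M'" "M \<subseteq> M'"
proof -
  have "finite {N. matching G N \<and> M \<subseteq> N}"
    by (rule finite_subset[of _ "Pow (edges G)"]) (auto simp: matching_def finite_edges[OF G])
  then obtain M' where M': "matching G M'" "M \<subseteq> M'"
    and max: "\<And>N. matching G N \<Longrightarrow> M \<subseteq> N \<Longrightarrow> M' \<subseteq> N \<Longrightarrow> M' = N"
    using finite_has_maximal2[of "{N. matching G N \<and> M \<subseteq> N}" M] M by auto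
  then have "maximal_matching G M'" by (auto simp: maximal_matching_def)
  with M' that show thesis by blast
qed

text \<open>Yannakakis--Gavril exchange: if \<open>f = {v, w}\<close> shares \<open>v\<close> with another edge of \<open>F\<close>, then either
  \<open>f\<close> is redundant or some edge \<open>{w, x}\<close> is covered by \<open>f\<close> alone, and replacing \<open>f\<close> by \<open>{w, x}\<close>
  covers the additional vertex \<open>x\<close>.\<close>

lemma maximal_matching_le_edge_dominating:
  assumes G: "finite_simple_graph G"
    and "F \<subseteq> edges G" "independent_set G (verts G - \<Union>F)"
  shows "\<exists>M. maximal_matching G M \<and> card M \<le> card F"
  using assms(2,3)
\<comment> \<open>The order is lexicographic: dropping \<open>f\<close> lowers the number of edges,
  while an exchange does not raise it and lowers the number of uncovered vertices.\<close>
proof (induction F rule: wf_induct_rule[OF wf_measures[of "[card, \<lambda>F. card (verts G - \<Union>F)]"]])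
  case (1 F)
  have finV: "finite (verts G)" using G by (simp add: finite_simple_graph_def)
  have finF: "finite F" using 1 finite_edges[OF G] finite_subset by blast
  show ?case
  proof (cases "pairwise disjnt F")
    case True
    then show ?thesis using 1 maximal_matching_iff[OF G, of F] by (auto simp: matching_def)
  next
    case False
    then obtain e f v where ef: "e \<in> F" "f \<in> F" "e \<noteq> f" "v \<in> e" "v \<in> f"
      by (auto simp: pairwise_def disjnt_def)
    let ?F = "F - {f}"
    have card: "card ?F < card F" using ef(2) finF by (rule card_Diff1_less[rotated])
    show ?thesis
    proof (cases "independent_set G (verts G - \<Union>?F)")
      case True
      then obtain M where "maximal_matching G M" "card M \<le> card ?F"
        using 1(1)[of ?F] 1(2) card by auto
      then show ?thesis using card by auto
    next
      case False
      \<comment> \<open>Some edge is uncovered once \<open>f\<close> is dropped. Since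
        \<open>F\<close> covers it, one of its ends lies on \<open>f\<close>; that end is called
        \<open>w\<close>.\<close>
      then obtain x w where xw: "adj G w x" "w \<notin> \<Union>?F" "x \<notin> \<Union>?F"
        and w: "w \<in> f"
      proof -
        from False obtain a b where ab: "a \<in> verts G - \<Union>?F" "b \<in> verts G - \<Union>?F" "adj G a b"
          by (auto simp: independent_set_def)
        with 1(3) have "a \<in> f \<or> b \<in> f" by (auto simp: independent_set_def)
        then show thesis using ab that[of a b] that[of b a] adj_sym[of G a b] by auto
      qed
      have "v \<noteq> w" "x \<noteq> v" using xw ef by auto
      have "x \<noteq> w" using xw adj_irrefl[OF G] by auto
      have f: "f = {v, w}"
      proof -
        have "f \<in> edges G" using ef 1(2) by auto
        then obtain a b where "f = {a, b}" using edge_endpoints[OF G] by metis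
        then show ?thesis using w \<open>v \<in> f\<close> \<open>v \<noteq> w\<close> by auto
      qed
      let ?F' = "insert {w, x} ?F"
      have U: "\<Union>?F' = insert x (\<Union>F)" using ef f by blast
      have x: "x \<in> verts G" "x \<notin> \<Union>F" using xw adj_verts[OF G] f \<open>x \<noteq> v\<close> \<open>x \<noteq> w\<close> by auto
      have "card ?F' \<le> Suc (card ?F)"
        using finF card_insert_if[of ?F "{w, x}"] by (simp split: if_splits)
      then have c: "card ?F' \<le> card F" using card by linarith
      have "card (verts G - \<Union>?F') < card (verts G - \<Union>F)"
        unfolding U using x finV by (intro psubset_card_mono) auto
      moreover have "?F' \<subseteq> edges G" using 1(2) xw by (auto simp: adj_def)
      moreover have "independent_set G (verts G - \<Union>?F')"
        unfolding U using 1(3) by (auto simp: independent_set_def)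
      moreover have "(?F', F) \<in> measures [card, \<lambda>F. card (verts G - \<Union>F)]"
        using calculation(1) c by (simp only: measures_less measures_lesseq)
      ultimately obtain M where "maximal_matching G M" "card M \<le> card ?F'"
        using 1(1)[of ?F'] by blast
      then show ?thesis using c le_trans by blast
    qed
  qed
qed

section \<open>The isolation number as the minimum size of a maximal matching\<close>

text \<open>The middle vertices of the edges of \<open>M\<close> form an isolating set, because the
  vertices left unmatched by \<open>M\<close> are independent.\<close>

lemma isolation_number_middle_graph_le:
  assumes G: "finite_simple_graph G" and M: "maximal_matching G M"
  shows "isolation_number (middle_graph G) \<le> card M"
proof -
  have "Inr -` (Inr ` M :: ('a + 'a set) set) = M" "Inl -` (Inr ` M :: ('a + 'a set) set) = {}"
    by auto
  then have "isolating_set (middle_graph G) (Inr ` M)"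
    using M unfolding isolating_set_middle_graph_iff[OF G] maximal_matching_iff[OF G]
    by (auto simp: matching_def)
  then have "isolation_number (middle_graph G) \<le> card (Inr ` M :: ('a + 'a set) set)"
    using finite_simple_middle_graph[OF G] isolation_number_le
    unfolding finite_simple_graph_def by blast
  then show ?thesis using card_image_le[of M] by (simp add: card_image)
qed

lemma isolation_number_middle_graph_attained:
  assumes G: "finite_simple_graph G"
  obtains M where "maximal_matching G M" "card M = isolation_number (middle_graph G)"
proof -
  have "finite (verts (middle_graph G))"
    using finite_simple_middle_graph[OF G] by (simp add: finite_simple_graph_def)
  then obtain S where "isolating_set (middle_graph G) S"
    and cS: "card S = isolation_number (middle_graph G)"
    by (rule isolation_number_attained)
  then have S: "S \<subseteq> verts G <+> edges G"
    and ind: "independent_set G (verts G - (Inl -` S \<union> \<Union>(Inr -` S)))"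
    by (auto simp: isolating_set_middle_graph_iff[OF G])
  \<comment> \<open>A chosen vertex without incident edges has no edge to replace it, but it covers
    no edge either, so it is simply dropped.\<close>
  define A where "A = Inl -` S \<inter> \<Union>(edges G)"
  have "\<forall>a\<in>A. \<exists>e. e \<in> edges G \<and> a \<in> e" by (auto simp: A_def)
  then obtain g where g: "\<And>a. a \<in> A \<Longrightarrow> g a \<in> edges G \<and> a \<in> g a" by metis
  let ?F = "g ` A \<union> Inr -` S"
  have "finite S" using S G finite_edges[OF G]
    by (metis finite_Plus finite_simple_graph_def finite_subset)
  then have fin: "finite (Inl -` S)" "finite (Inr -` S)"
    by (auto intro: finite_vimageI)
  have "card ?F \<le> card (g ` A) + card (Inr -` S)" by (rule card_Un_le)
  also have "\<dots> \<le> card (Inl -` S) + card (Inr -` S)"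
    using fin card_image_le[of A g] card_mono[of "Inl -` S" A] finite_subset[of A "Inl -` S"]
    by (auto simp: A_def)
  also have "\<dots> = card S"
  proof -
    have "S = Inl -` S <+> Inr -` S"
    proof (rule set_eqI)
      show "x \<in> S \<longleftrightarrow> x \<in> Inl -` S <+> Inr -` S" for x by (cases x) auto
    qed
    then show ?thesis using card_Plus[OF fin] by simp
  qed
  finally have cF: "card ?F \<le> card S" .
  have "?F \<subseteq> edges G" using g S by auto
  moreover have "independent_set G (verts G - \<Union>?F)"
    unfolding independent_set_def
  proof (intro conjI ballI notI)
    fix u v assume u: "u \<in> verts G - \<Union>?F" and v: "v \<in> verts G - \<Union>?F" and uv: "adj G u v"
    then have "u \<in> \<Union>(edges G)" "v \<in> \<Union>(edges G)" by (auto simp: adj_def)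
    moreover have "u \<notin> A" "v \<notin> A" using u v g by auto
    ultimately have "u \<notin> Inl -` S" "v \<notin> Inl -` S" by (auto simp: A_def)
    then show False using ind u v uv by (auto simp: independent_set_def)
  qed auto
  ultimately obtain M where "maximal_matching G M" "card M \<le> card ?F"
    using maximal_matching_le_edge_dominating[OF G] by blast
  with that show thesis using cF cS isolation_number_middle_graph_le[OF G]
    by (metis le_antisym le_trans)
qed

section \<open>Complete and complete bipartite graphs described by adjacency alone\<close>

lemma graph_iso_complete_graph_iff:
  assumes "finite (verts G)" "card (verts G) = n"
  shows "graph_iso G (complete_graph n) \<longleftrightarrow>
    (\<forall>u\<in>verts G. \<forall>v\<in>verts G. adj G u v \<longleftrightarrow> u \<noteq> v)"
proof -
  have adj: "adj (complete_graph n) i j \<longleftrightarrow> i < n \<and> j < n \<and> i \<noteq> j" for i j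
    by (auto simp: adj_def complete_graph_def doubleton_eq_iff)
  have verts: "verts (complete_graph n) = {..<n}" by (simp add: complete_graph_def)
  show ?thesis
  proof
    assume "graph_iso G (complete_graph n)"
    then obtain f where f: "bij_betw f (verts G) {..<n}"
      "\<forall>u\<in>verts G. \<forall>v\<in>verts G. adj G u v \<longleftrightarrow> adj (complete_graph n) (f u) (f v)"
      by (auto simp: graph_iso_def verts)
    then show "\<forall>u\<in>verts G. \<forall>v\<in>verts G. adj G u v \<longleftrightarrow> u \<noteq> v"
      by (auto simp: adj bij_betw_def inj_on_def)
  next
    assume a: "\<forall>u\<in>verts G. \<forall>v\<in>verts G. adj G u v \<longleftrightarrow> u \<noteq> v"
    obtain f where "bij_betw f (verts G) {..<n}"
      using ex_bij_betw_finite_nat[OF assms(1)] assms(2) by (auto simp: atLeast0LessThan)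
    then show "graph_iso G (complete_graph n)"
      unfolding graph_iso_def adj verts using a
      by (intro exI[of _ f]) (auto simp: bij_betw_def inj_on_def)
  qed
qed

lemma graph_iso_complete_bipartite_graph_iff:
  assumes fin: "finite (verts G)"
  shows "graph_iso G (complete_bipartite_graph m n) \<longleftrightarrow>
    (\<exists>X\<subseteq>verts G. card X = m \<and> card (verts G - X) = n \<and>
      (\<forall>u\<in>verts G. \<forall>v\<in>verts G. adj G u v \<longleftrightarrow> (u \<in> X) \<noteq> (v \<in> X)))" (is "_ \<longleftrightarrow> ?R")
proof -
  let ?K = "complete_bipartite_graph m n"
  have adj: "\<not> adj ?K (Inl i) (Inl i')" "\<not> adj ?K (Inr j) (Inr j')"
    "adj ?K (Inl i) (Inr j) \<longleftrightarrow> i < m \<and> j < n" "adj ?K (Inr j) (Inl i) \<longleftrightarrow> i < m \<and> j < n"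
    for i i' j j'
    by (auto simp: adj_def complete_bipartite_graph_def doubleton_eq_iff)
  have verts: "verts ?K = {..<m} <+> {..<n}" by (simp add: complete_bipartite_graph_def)
  show ?thesis
  proof
    assume "graph_iso G ?K"
    then obtain f where f: "bij_betw f (verts G) ({..<m} <+> {..<n})"
      "\<forall>u\<in>verts G. \<forall>v\<in>verts G. adj G u v \<longleftrightarrow> adj ?K (f u) (f v)"
      by (auto simp: graph_iso_def verts)
    \<comment> \<open>The side \<open>X\<close> consists of the vertices that the isomorphism sends
      to the left summand.\<close>
    define X where "X = {v \<in> verts G. isl (f v)}"
    have "f ` X = {y \<in> f ` verts G. isl y}" by (auto simp: X_def)
    also have "\<dots> = Inl ` {..<m}" unfolding bij_betw_imp_surj_on[OF f(1)] by auto
    finally have X: "f ` X = Inl ` {..<m}" .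
    have "f ` (verts G - X) = {y \<in> f ` verts G. \<not> isl y}" by (auto simp: X_def)
    also have "\<dots> = Inr ` {..<n}" unfolding bij_betw_imp_surj_on[OF f(1)] by auto
    finally have Y: "f ` (verts G - X) = Inr ` {..<n}" .
    have "inj_on f X" "inj_on f (verts G - X)"
      using f(1) by (auto simp: bij_betw_def X_def inj_on_def)
    from this[THEN card_image] have "card X = m" "card (verts G - X) = n"
      by (simp_all add: X Y card_image)
    moreover have "adj G u v \<longleftrightarrow> (u \<in> X) \<noteq> (v \<in> X)" if uv: "u \<in> verts G" "v \<in> verts G" for u v
    proof -
      have "f u \<in> {..<m} <+> {..<n}" "f v \<in> {..<m} <+> {..<n}"
        using f(1) uv by (auto simp: bij_betw_def)
      then show ?thesis using f(2) uv by (cases "f u"; cases "f v") (auto simp: adj X_def)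
    qed
    ultimately show ?R by (intro exI[of _ X]) (auto simp: X_def)
  next
    assume ?R
    then obtain X where X: "X \<subseteq> verts G" "card X = m" "card (verts G - X) = n"
      and a: "\<And>u v. u \<in> verts G \<Longrightarrow> v \<in> verts G \<Longrightarrow> adj G u v \<longleftrightarrow> (u \<in> X) \<noteq> (v \<in> X)" by blast
    have "finite X" "finite (verts G - X)" using X fin finite_subset by auto
    then obtain g h where g: "bij_betw g X {..<m}" and h: "bij_betw h (verts G - X) {..<n}"
      using ex_bij_betw_finite_nat[of X] ex_bij_betw_finite_nat[of "verts G - X"] X
      by (auto simp: atLeast0LessThan)
    define f where "f v = (if v \<in> X then Inl (g v) else Inr (h v))" for v
    have "bij_betw f (verts G) ({..<m} <+> {..<n})"
    proof -
      have "bij_betw f X (Inl ` {..<m})"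
        using g by (auto simp: bij_betw_def inj_on_def f_def image_iff)
      moreover have "bij_betw f (verts G - X) (Inr ` {..<n})"
        using h by (auto simp: bij_betw_def inj_on_def f_def image_iff)
      ultimately have "bij_betw f (X \<union> (verts G - X)) (Inl ` {..<m} \<union> Inr ` {..<n})"
        by (rule bij_betw_combine) auto
      then show ?thesis using X by (simp add: Plus_def Un_absorb1)
    qed
    moreover have "g u < m" if "u \<in> X" for u using g that by (auto simp: bij_betw_def)
    moreover have "h u < n" if "u \<in> verts G" "u \<notin> X" for u using h that by (auto simp: bij_betw_def)
    ultimately show "graph_iso G ?K"
      unfolding graph_iso_def verts by (intro exI[of _ f]) (auto simp: a f_def adj)
  qed
qed

section \<open>Maximal matchings of the two extremal graphs of even order\<close>

text \<open>By parity, a matching that is not perfect leaves at least two vertices unmatched. These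
  are adjacent, against maximality.\<close>

lemma complete_maximal_matching_perfect:
  assumes G: "finite_simple_graph G" and "even (card (verts G))"
    and a: "\<forall>u\<in>verts G. \<forall>v\<in>verts G. adj G u v \<longleftrightarrow> u \<noteq> v"
    and M: "maximal_matching G M"
  shows "2 * card M = card (verts G)"
proof (rule ccontr)
  assume "2 * card M \<noteq> card (verts G)"
  moreover have m: "matching G M" using M by (simp add: maximal_matching_def)
  ultimately have "card (verts G - \<Union>M) \<ge> 2"
    using card_unmatched[OF G m] \<open>even _\<close> by presburger
  then obtain T where "T \<subseteq> verts G - \<Union>M" "card T = 2" by (metis obtain_subset_with_card_n)
  then obtain u v where "u \<noteq> v" "u \<in> verts G - \<Union>M" "v \<in> verts G - \<Union>M" by (auto simp: card_2_iff)
  then show False using M a by (auto simp: maximal_matching_iff[OF G] independent_set_def)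
qed

text \<open>Every edge has one end on each side, so \<open>M\<close> covers \<open>card M\<close>
  vertices of either side. As the sides have equal size, an imperfect \<open>M\<close> misses a
  vertex on both, and these two are adjacent.\<close>

lemma balanced_complete_bipartite_maximal_matching_perfect:
  assumes G: "finite_simple_graph G" and X: "X \<subseteq> verts G" "card (verts G - X) = card X"
    and a: "\<forall>u\<in>verts G. \<forall>v\<in>verts G. adj G u v \<longleftrightarrow> (u \<in> X) \<noteq> (v \<in> X)"
    and M: "maximal_matching G M"
  shows "2 * card M = card (verts G)"
proof -
  have m: "matching G M" using M by (simp add: maximal_matching_def)
  have fin: "finite (verts G)" using G by (simp add: finite_simple_graph_def)
  have "finite M" using m finite_edges[OF G] finite_subset by (auto simp: matching_def)
  have cardY: "card (\<Union>M \<inter> Y) = card M" if "\<And>e. e \<in> edges G \<Longrightarrow> card (e \<inter> Y) = 1" for Y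
  proof -
    have "\<Union>M \<inter> Y = (\<Union>e\<in>M. e \<inter> Y)" by auto
    also have "card \<dots> = (\<Sum>e\<in>M. card (e \<inter> Y))"
    proof (rule card_UN_disjoint[OF \<open>finite M\<close>])
      show "\<forall>e\<in>M. finite (e \<inter> Y)"
        using fin Union_matching_subset[OF G m] by (auto intro: finite_subset)
      show "\<forall>e\<in>M. \<forall>f\<in>M. e \<noteq> f \<longrightarrow> e \<inter> Y \<inter> (f \<inter> Y) = {}"
        using m unfolding matching_def pairwise_def disjnt_def by blast
    qed
    also have "\<dots> = (\<Sum>e\<in>M. 1)" using m that by (intro sum.cong) (auto simp: matching_def)
    finally show ?thesis by simp
  qed
  have "card (e \<inter> X) = 1" "card (e \<inter> (verts G - X)) = 1" if e: "e \<in> edges G" for e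
  proof -
    obtain u v where uv: "e = {u, v}" "adj G u v" using edge_endpoints[OF G e] by metis
    with a adj_verts[OF G] have "u \<in> verts G" "v \<in> verts G" "(u \<in> X) \<noteq> (v \<in> X)" by blast+
    with uv show "card (e \<inter> X) = 1" "card (e \<inter> (verts G - X)) = 1" by auto
  qed
  then have c: "card (\<Union>M \<inter> X) = card M" "card (\<Union>M \<inter> (verts G - X)) = card M" using cardY by auto
  have ind: "independent_set G (verts G - \<Union>M)" using M by (simp add: maximal_matching_iff[OF G])
  have "card M = card X"
  proof (rule ccontr)
    assume "card M \<noteq> card X"
    then have "\<not> X \<subseteq> \<Union>M" "\<not> verts G - X \<subseteq> \<Union>M"
      using c X(2) by (metis inf.absorb2)+
    then obtain u v where uv: "u \<in> X" "u \<notin> \<Union>M" "v \<in> verts G" "v \<notin> X" "v \<notin> \<Union>M" by blast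
    then have "adj G u v" using a X(1) by blast
    then show False using ind uv X(1) unfolding independent_set_def by blast
  qed
  then show ?thesis
    using X fin card_Diff_subset[of X "verts G"] card_mono[of "verts G" X]
      finite_subset[of X "verts G"] by auto
qed

section \<open>Exchanges when every maximal matching is perfect\<close>

text \<open>Replacing \<open>F\<close> by \<open>N\<close> in the perfect matching \<open>M\<close>
  gives a matching that misses only \<open>u\<close> and \<open>v\<close>. It extends to a maximal
  matching, which is perfect by assumption and therefore has to join \<open>u\<close> to
  \<open>v\<close>.\<close>

lemma randomly_matchable_exchange:
  assumes G: "finite_simple_graph G"
    and perf: "\<And>M. maximal_matching G M \<Longrightarrow> \<Union>M = verts G"
    and M: "matching G M" "\<Union>M = verts G"
    and F: "F \<subseteq> M" and N: "matching G N"
    and FN: "\<Union>F = insert u (insert v (\<Union>N))" "u \<notin> \<Union>N" "v \<notin> \<Union>N"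
  shows "adj G u v"
proof -
  have disj: "e \<inter> \<Union>F = {}" if "e \<in> M - F" for e
    using that M(1) F by (fastforce simp: matching_def pairwise_def disjnt_def)
  have "matching G ((M - F) \<union> N)"
    unfolding matching_def pairwise_def disjnt_def
  proof (intro conjI ballI impI)
    show "M - F \<union> N \<subseteq> edges G" using M N by (auto simp: matching_def)
    fix e f assume ef: "e \<in> M - F \<union> N" "f \<in> M - F \<union> N" "e \<noteq> f"
    have *: "x \<inter> y = {}" if "x \<in> M - F" "y \<in> N" for x y
      using disj[OF that(1)] that FN by auto
    from ef show "e \<inter> f = {}"
    proof (elim UnE)
      assume "e \<in> M - F" "f \<in> M - F"
      then show ?thesis using M(1) ef(3) unfolding matching_def pairwise_def disjnt_def by blast
    next
      assume "e \<in> N" "f \<in> N"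
      then show ?thesis using N ef(3) unfolding matching_def pairwise_def disjnt_def by blast
    qed (use *[of e f] *[of f e] in auto)
  qed
  then obtain M' where M': "maximal_matching G M'" "(M - F) \<union> N \<subseteq> M'"
    using matching_extends_to_maximal[OF G] by metis
  have u: "u \<in> verts G" using FN(1) F M(2) by blast
  from u perf[OF M'(1)] obtain e where e: "e \<in> M'" "u \<in> e" by blast
  have eE: "e \<in> edges G" using M' e by (auto simp: maximal_matching_def matching_def)
  then obtain x where x: "e = {u, x}" "x \<noteq> u" "adj G u x"
    using edge_endpoints[OF G] e(2) by (metis adj_sym doubleton_eq_iff insertE singletonD)
  have "u \<in> \<Union>F" using FN(1) by simp
  then have "e \<notin> M - F" using e(2) disj[of e] by blast
  moreover have "e \<notin> N" using e(2) FN(2) by blast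
  moreover have "pairwise disjnt M'" using M'(1) by (simp add: maximal_matching_def matching_def)
  \<comment> \<open>The edge \<open>e\<close> at \<open>u\<close> is none of the edges kept or
    inserted, so it is disjoint from all of them; the only place left for its other end is
    \<open>v\<close>.\<close>
  ultimately have "e \<inter> f = {}" if "f \<in> (M - F) \<union> N" for f
    using that e(1) M'(2) pairwiseD[of disjnt M' e f] by (auto simp: disjnt_def)
  then have "e \<inter> \<Union>((M - F) \<union> N) = {}" by blast
  moreover have "verts G = insert u (insert v (\<Union>((M - F) \<union> N)))"
  proof -
    have "verts G = \<Union>(M - F) \<union> \<Union>F" using F M(2) by blast
    then show ?thesis unfolding FN(1) by auto
  qed
  moreover have "x \<in> verts G" using x adj_verts[OF G] by blast
  ultimately have "x = v" using x by auto
  with x show ?thesis by simp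
qed

section \<open>The structure forced by alternating paths\<close>

text \<open>\<open>R\<close> stands for adjacency and \<open>p\<close> for the partner map of a
  perfect matching. \<open>switch2\<close> comes from the alternating path \<open>p u\<close>,
  \<open>u\<close>, \<open>v\<close>, \<open>p v\<close>, and \<open>switch3\<close> from
  \<open>p u\<close>, \<open>u\<close>, \<open>w\<close>, \<open>p w\<close>, \<open>p v\<close>,
  \<open>v\<close>; in both cases the ends of the path turn out adjacent.\<close>

locale matched_partner =
  fixes V :: "'a set" and R :: "'a \<Rightarrow> 'a \<Rightarrow> bool" and p :: "'a \<Rightarrow> 'a"
  assumes R_V: "R u v \<Longrightarrow> u \<in> V \<and> v \<in> V"
    and R_sym: "R u v \<Longrightarrow> R v u"
    and R_irrefl: "\<not> R v v"
    and p_adj: "v \<in> V \<Longrightarrow> R v (p v)"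
    and p_p: "v \<in> V \<Longrightarrow> p (p v) = v"
    and switch2: "R u v \<Longrightarrow> v \<noteq> p u \<Longrightarrow> R (p u) (p v)"
    and switch3: "R u w \<Longrightarrow> R w v \<Longrightarrow> w \<noteq> p u \<Longrightarrow> v \<noteq> p w \<Longrightarrow> v \<noteq> u \<Longrightarrow> v \<noteq> p u \<Longrightarrow> R (p u) v"
    and conn: "u \<in> V \<Longrightarrow> v \<in> V \<Longrightarrow> R\<^sup>*\<^sup>* u v"
begin

lemma p_V: "v \<in> V \<Longrightarrow> p v \<in> V"
  using p_adj R_V by blast

text \<open>Walking from \<open>u\<close> to \<open>v\<close>, each vertex reached lies on the
  matching edge of \<open>u\<close> or on a matching edge with an end adjacent to \<open>u\<close>.
  The switches carry this property across each step of the walk.\<close>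

lemma adj_or_adj_partner:
  assumes "u \<in> V" "v \<in> V" "v \<noteq> u" "v \<noteq> p u"
  shows "R u v \<or> R u (p v)"
proof -
  have "R\<^sup>*\<^sup>* u v" using conn assms by blast
  then have "v = u \<or> v = p u \<or> R u v \<or> R u (p v)"
  proof (induction rule: rtranclp_induct)
    case base
    then show ?case by simp
  next
    case (step v v')
    have V: "v \<in> V" "v' \<in> V" using step R_V by blast+
    have *: "R u v' \<or> R u (p v')" if "R (p u) v'" "v' \<noteq> u"
      using switch2[of "p u" v'] that p_p \<open>u \<in> V\<close> by metis
    show ?case
    proof (cases "v' = u \<or> v' = p u \<or> v' = p v \<or> v = u \<or> v = p u")
      case True
      then show ?thesis using step * p_p V by metis
    next
      case False
      from step.IH False consider "R u v" | "R u (p v)" by blast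
      then show ?thesis
      proof cases
        case 1
        then have "R (p u) v'" using switch3[of u v v'] step(2) False by blast
        then show ?thesis using * False by blast
      next
        case 2
        \<comment> \<open>The step is mirrored to the partners: \<open>switch3\<close> along
          \<open>u\<close>, \<open>p v\<close>, \<open>p v'\<close> gives
          \<open>R (p u) (p v')\<close>, and \<open>switch2\<close> turns this into
          \<open>R u v'\<close>.\<close>
        have "R (p v) (p v')" using switch2 step(2) False by blast
        moreover have "p v \<noteq> p u" "p v' \<noteq> p (p v)" "p v' \<noteq> u" "p v' \<noteq> p u"
          using False p_p V \<open>u \<in> V\<close> by metis+
        ultimately have "R (p u) (p v')" using switch3[of u "p v" "p v'"] 2 by blast
        then have "R (p (p u)) (p (p v'))" using switch2 \<open>p v' \<noteq> u\<close> p_p \<open>u \<in> V\<close> by metis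
        then show ?thesis using p_p V \<open>u \<in> V\<close> by metis
      qed
    qed
  qed
  then show ?thesis using assms by blast
qed

text \<open>By \<open>switch2\<close> this amounts to all four cross edges being present between the
  matching edge of \<open>u\<close> and another one.\<close>

definition double :: "'a \<Rightarrow> bool" where
  "double u \<longleftrightarrow> (\<exists>w. w \<noteq> u \<and> w \<noteq> p u \<and> R u w \<and> R u (p w))"

text \<open>If \<open>u\<close> were not adjacent to \<open>v\<close>, it would be adjacent to
  \<open>p v\<close>. The switches pass this adjacency on to \<open>w\<close> and \<open>v\<close>,
  and from there back to \<open>u\<close> and \<open>v\<close>.\<close>

lemma double_adj_all:
  assumes "double u" "v \<in> V" "v \<noteq> u"
  shows "R u v"
proof -
  from \<open>double u\<close> obtain w where w: "w \<noteq> u" "w \<noteq> p u" "R u w" "R u (p w)" by (auto simp: double_def)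
  have V: "u \<in> V" "w \<in> V" using w R_V by auto
  show ?thesis
  proof (cases "v = p u \<or> v = w \<or> v = p w")
    case True
    then show ?thesis using w p_adj V by auto
  next
    case False
    show ?thesis
    proof (rule ccontr)
      assume "\<not> R u v"
      then have upv: "R u (p v)" using adj_or_adj_partner[of u v] V assms False by blast
      note d = p_p[OF V(1)] p_p[OF V(2)] p_p[OF assms(2)] p_V[OF V(1)] p_V[OF V(2)] p_V[OF assms(2)]
      \<comment> \<open>The path used is \<open>w\<close>, \<open>u\<close>,
        \<open>p v\<close>.\<close>
      have "R (p w) (p v)"
        by (rule switch3[of w u "p v"]) (use w upv False assms d R_sym in \<open>metis+\<close>)
      then have "R w v" using switch2[of "p w" "p v"] d False by metis
      have "R (p u) w" using switch2[of u "p w"] w d by metis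
      \<comment> \<open>The path used is \<open>p u\<close>, \<open>w\<close>, \<open>v\<close>; its
        first vertex has partner \<open>u\<close>.\<close>
      then have "R (p (p u)) v"
        by (rule switch3[OF _ \<open>R w v\<close>]) (use w False assms d in \<open>metis+\<close>)
      then show False using d \<open>\<not> R u v\<close> by simp
    qed
  qed
qed

text \<open>Doubleness spreads from \<open>a\<close> to every vertex: \<open>p a\<close> inherits
  it, so both are adjacent to all other vertices, and hence any other \<open>u\<close> is adjacent
  to both ends of the matching edge of \<open>a\<close>.\<close>

lemma double_complete:
  assumes a: "double a" and "u \<in> V" "v \<in> V"
  shows "R u v \<longleftrightarrow> u \<noteq> v"
proof -
  have aV: "a \<in> V" using a R_V by (auto simp: double_def)
  have "double (p a)"
  proof -
    from a obtain w where w: "w \<noteq> a" "w \<noteq> p a" "R a w" "R a (p w)" by (auto simp: double_def)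
    have "w \<in> V" using w R_V by blast
    then have "R (p a) (p w)" "R (p a) w" using switch2[of a w] switch2[of a "p w"] w p_p aV by metis+
    then show ?thesis using w p_p aV by (metis double_def)
  qed
  moreover have "double u" if "u \<noteq> a" "u \<noteq> p a"
  proof -
    have "R u a" "R u (p a)"
      using double_adj_all[OF a \<open>u \<in> V\<close>] double_adj_all[OF \<open>double (p a)\<close> \<open>u \<in> V\<close>] that R_sym by auto
    moreover have "a \<noteq> p u" using that p_p \<open>u \<in> V\<close> by metis
    ultimately show ?thesis using that by (auto simp: double_def)
  qed
  ultimately have "double u" using a by metis
  then show ?thesis using double_adj_all assms R_irrefl by metis
qed

text \<open>Without double vertices, \<open>a\<close> is adjacent to exactly one end of every
  matching edge, so its neighbourhood \<open>X\<close> picks one end of each. It remains to see that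
  \<open>X\<close> and its complement are independent and fully joined.\<close>

lemma not_double_bipartite:
  assumes nd: "\<And>u. \<not> double u" and "a \<in> V"
  defines "X \<equiv> {v. R a v}"
  shows "\<And>v. v \<in> V \<Longrightarrow> p v \<in> X \<longleftrightarrow> v \<notin> X"
    and "\<And>u v. u \<in> V \<Longrightarrow> v \<in> V \<Longrightarrow> R u v \<longleftrightarrow> (u \<in> X) \<noteq> (v \<in> X)"
proof -
  have one: "\<not> R u (p w)" if "R u w" "w \<noteq> p u" for u w
    using nd[of u] that R_irrefl by (auto simp: double_def)
  show pX: "p v \<in> X \<longleftrightarrow> v \<notin> X" if v: "v \<in> V" for v
  proof (cases "v = a \<or> v = p a")
    case True
    then show ?thesis using p_adj p_p R_irrefl \<open>a \<in> V\<close> by (auto simp: X_def)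
  next
    case False
    then show ?thesis using one[of a v] adj_or_adj_partner[of a v] v \<open>a \<in> V\<close> by (auto simp: X_def)
  qed
  have XX: "\<not> R u v" if uv: "u \<in> X" "v \<in> X" for u v
  proof
    assume "R u v"
    have V: "u \<in> V" "v \<in> V" using \<open>R u v\<close> R_V by auto
    have au: "R a u" "R a v" using uv by (auto simp: X_def)
    have ne: "v \<noteq> p u" "u \<noteq> p v" using uv pX V by auto
    have na: "u \<noteq> a" "v \<noteq> a" using au R_irrefl by auto
    \<comment> \<open>A common neighbour of \<open>a\<close> and \<open>p a\<close> would be double.
      This excludes the degenerate cases of the \<open>switch3\<close> step below.\<close>
    have nb: "x \<noteq> p a" if xy: "R x y" "R a y" for x y
    proof
      assume "x = p a"
      then have "R y a" "R y (p a)" "y \<noteq> p a" using xy R_sym R_irrefl by blast+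
      moreover have "a \<noteq> p y" using p_p R_V xy \<open>y \<noteq> p a\<close> by metis
      ultimately show False using one by blast
    qed
    have "u \<noteq> p a" "v \<noteq> p a" using nb \<open>R u v\<close> R_sym au by blast+
    \<comment> \<open>The triangle on \<open>a\<close>, \<open>u\<close>, \<open>v\<close> is read
      as the path \<open>u\<close>, \<open>v\<close>, \<open>a\<close>. The result puts
      \<open>p u\<close> into \<open>X\<close> together with \<open>u\<close>.\<close>
    have "R (p u) a"
      by (rule switch3[of u v a])
        (use \<open>R u v\<close> au R_sym na ne \<open>u \<noteq> p a\<close> \<open>v \<noteq> p a\<close> p_p \<open>a \<in> V\<close> V in \<open>metis+\<close>)
    then show False using pX[of u] V uv R_sym by (auto simp: X_def)
  qed
  fix u v assume V: "u \<in> V" "v \<in> V"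
  \<comment> \<open>An edge outside \<open>X\<close> would be mirrored by \<open>switch2\<close> to
    an edge inside \<open>X\<close>.\<close>
  have YY: "\<not> R u v" if "u \<notin> X" "v \<notin> X"
    using that XX[of "p u" "p v"] switch2[of u v] pX V by metis
  have XY: "R u v" if "u \<in> X" "v \<notin> X" "u \<in> V" "v \<in> V" for u v
  proof (cases "v = p u")
    case True
    then show ?thesis using p_adj that by blast
  next
    case False
    then show ?thesis using adj_or_adj_partner[of u v] XX[of u "p v"] pX that by metis
  qed
  show "R u v \<longleftrightarrow> (u \<in> X) \<noteq> (v \<in> X)"
    using XX YY XY[of u v] XY[of v u] V R_sym by metis
qed

end

section \<open>From perfect matchings to the two extremal graphs\<close>

lemma perfect_matching_partner:
  assumes G: "finite_simple_graph G" and M: "matching G M" "\<Union>M = verts G"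
  obtains p where "\<And>v. v \<in> verts G \<Longrightarrow> {v, p v} \<in> M"
    "\<And>v. v \<in> verts G \<Longrightarrow> p v \<in> verts G"
    "\<And>v. v \<in> verts G \<Longrightarrow> p (p v) = v"
    "\<And>v. v \<in> verts G \<Longrightarrow> adj G v (p v)"
proof -
  have "\<exists>w. {v, w} \<in> M" if v: "v \<in> verts G" for v
  proof -
    obtain e where e: "e \<in> M" "v \<in> e" using v M(2) by (metis UnionE)
    then have "e \<in> edges G" using M by (auto simp: matching_def)
    then obtain a b where "e = {a, b}" using edge_endpoints[OF G] by metis
    with e have "e = {v, a} \<or> e = {v, b}" by auto
    with e show ?thesis by blast
  qed
  then obtain p where p: "\<And>v. v \<in> verts G \<Longrightarrow> {v, p v} \<in> M" by metis
  have adj: "adj G v (p v)" if "v \<in> verts G" for v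
    using p[OF that] M by (auto simp: adj_def matching_def)
  have pV: "p v \<in> verts G" if "v \<in> verts G" for v
    using adj[OF that] adj_verts[OF G] by blast
  have "p (p v) = v" if v: "v \<in> verts G" for v
  proof -
    have "{v, p v} \<inter> {p v, p (p v)} \<noteq> {}" by auto
    then have "{v, p v} = {p v, p (p v)}"
      using M(1) p[OF v] p[OF pV[OF v]] pairwiseD[of disjnt M "{v, p v}" "{p v, p (p v)}"]
      by (auto simp: matching_def disjnt_def)
    then show ?thesis using adj[OF v] adj[OF pV[OF v]] adj_irrefl[OF G] by (metis doubleton_eq_iff)
  qed
  with p adj pV that show thesis by blast
qed

text \<open>This is Sumner's theorem on randomly matchable graphs.\<close>

lemma randomly_matchable_complete_or_bipartite:
  assumes G: "finite_simple_graph G" and connected: "connected_graph G"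
    and perf: "\<And>M. maximal_matching G M \<Longrightarrow> \<Union>M = verts G"
  shows "(\<forall>u\<in>verts G. \<forall>v\<in>verts G. adj G u v \<longleftrightarrow> u \<noteq> v) \<or>
    (\<exists>X\<subseteq>verts G. card (verts G - X) = card X \<and>
      (\<forall>u\<in>verts G. \<forall>v\<in>verts G. adj G u v \<longleftrightarrow> (u \<in> X) \<noteq> (v \<in> X)))"
proof -
  have "matching G {}" by (simp add: matching_def)
  then obtain M where "maximal_matching G M" using matching_extends_to_maximal[OF G] by metis
  then have M: "matching G M" "\<Union>M = verts G" using perf by (auto simp: maximal_matching_def)
  obtain p where p: "\<And>v. v \<in> verts G \<Longrightarrow> {v, p v} \<in> M"
    and pV: "\<And>v. v \<in> verts G \<Longrightarrow> p v \<in> verts G"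
    and pp: "\<And>v. v \<in> verts G \<Longrightarrow> p (p v) = v"
    and padj: "\<And>v. v \<in> verts G \<Longrightarrow> adj G v (p v)"
    using perfect_matching_partner[OF G M] by metis
  note exchange = randomly_matchable_exchange[OF G perf M]
  have pneq: "p v \<noteq> v" if "v \<in> verts G" for v using padj[OF that] adj_irrefl[OF G] by metis
  have switch2: "adj G (p u) (p v)" if uv: "adj G u v" "v \<noteq> p u" for u v
  proof -
    have V: "u \<in> verts G" "v \<in> verts G" using uv adj_verts[OF G] by auto
    have ne: "u \<noteq> v" using uv adj_irrefl[OF G] by auto
    have "p u \<noteq> v" "p v \<noteq> u" "p u \<noteq> u" "p v \<noteq> v" using V uv(2) pp pneq by metis+
    then show ?thesis
      using V p uv by (intro exchange[of "{{u, p u}, {v, p v}}" "{{u, v}}"])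
        (auto simp: matching_def adj_def)
  qed
  have switch3: "adj G (p u) v"
    if uwv: "adj G u w" "adj G w v" and ne: "w \<noteq> p u" "v \<noteq> p w" "v \<noteq> u" "v \<noteq> p u" for u w v
  proof -
    have V: "u \<in> verts G" "v \<in> verts G" "w \<in> verts G" using uwv adj_verts[OF G] by auto
    \<comment> \<open>With this edge and \<open>{u, w}\<close> the three matching edges can be
      traded for two, which frees exactly \<open>p u\<close> and \<open>v\<close>.\<close>
    have e: "adj G (p w) (p v)" using switch2 uwv ne by blast
    have "u \<noteq> w" "w \<noteq> v" using uwv adj_irrefl[OF G] by auto
    moreover have "p u \<noteq> u" "p v \<noteq> v" "p w \<noteq> w" "p u \<noteq> v" "p v \<noteq> u" "p u \<noteq> w" "p w \<noteq> u"
        "p v \<noteq> w" "p w \<noteq> v" "p u \<noteq> p v" "p v \<noteq> p w" "p u \<noteq> p w"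
      using V ne \<open>u \<noteq> w\<close> \<open>w \<noteq> v\<close> pp pneq by metis+
    ultimately show ?thesis
      using V p uwv e ne
      by (intro exchange[of "{{u, p u}, {w, p w}, {v, p v}}" "{{u, w}, {p w, p v}}"])
        (auto simp: matching_def adj_def pairwise_insert disjnt_def)
  qed
  interpret matched_partner "verts G" "adj G" p
  proof
    show "(adj G)\<^sup>*\<^sup>* u v" if "u \<in> verts G" "v \<in> verts G" for u v
      using connected that by (simp add: connected_graph_def)
  qed (fact adj_verts[OF G] adj_sym adj_irrefl[OF G] padj pp switch2 switch3)+
  show ?thesis
  proof (cases "\<exists>a. double a")
    case True
    then show ?thesis using double_complete by blast
  next
    case False
    obtain a where a: "a \<in> verts G" using connected by (auto simp: connected_graph_def)
    define X where "X = {v. adj G a v}"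
    have pX: "p v \<in> X \<longleftrightarrow> v \<notin> X" if "v \<in> verts G" for v
      using not_double_bipartite(1)[OF _ a] False that by (auto simp: X_def)
    have bip: "adj G u v \<longleftrightarrow> (u \<in> X) \<noteq> (v \<in> X)" if "u \<in> verts G" "v \<in> verts G" for u v
      using not_double_bipartite(2)[OF _ a] False that by (auto simp: X_def)
    have XV: "X \<subseteq> verts G" using adj_verts[OF G] by (auto simp: X_def)
    \<comment> \<open>The partner map swaps the two sides, so the bipartition is balanced.\<close>
    have "bij_betw p (verts G - X) X"
      by (rule bij_betw_byWitness[of _ p]) (use pp pX pV XV in auto)
    then have "card (verts G - X) = card X" by (rule bij_betw_same_card)
    then show ?thesis using XV bip by blast
  qed
qed

section \<open>The bound and its equality cases\<close>

theorem theorem6: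
  fixes G :: "'a ugraph" and n :: nat
  assumes "finite_simple_graph G"
    and "connected_graph G"
    and "card (verts G) = n"
  shows "isolation_number (middle_graph G) \<le> n div 2 \<and>
    (isolation_number (middle_graph G) = n div 2 \<longleftrightarrow>
      (even n \<longrightarrow>
         graph_iso G (complete_graph n) \<or>
         graph_iso G (complete_bipartite_graph (n div 2) (n div 2))) \<and>
      (odd n \<longrightarrow> (\<forall>M. maximal_matching G M \<longrightarrow> near_perfect_matching G M)))"
proof -
  note G = assms(1)
  have fin: "finite (verts G)" using G by (simp add: finite_simple_graph_def)
  let ?i = "isolation_number (middle_graph G)"
  obtain M0 where M0: "maximal_matching G M0" "card M0 = ?i"
    using isolation_number_middle_graph_attained[OF G] by metis
  have le: "card M \<le> n div 2" if "maximal_matching G M" for M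
    using that card_unmatched(2)[OF G, of M] assms(3) by (simp add: maximal_matching_def)
  have bound: "?i \<le> n div 2" using M0 le by metis
  \<comment> \<open>The isolation number is the least size of a maximal matching and no matching
    exceeds \<open>n div 2\<close>, so equality forces all maximal matchings to this size.\<close>
  have eq: "?i = n div 2 \<longleftrightarrow> (\<forall>M. maximal_matching G M \<longrightarrow> card M = n div 2)"
    using M0 le isolation_number_middle_graph_le[OF G] by (metis le_antisym)
  have odd_case: "card M = n div 2 \<longleftrightarrow> near_perfect_matching G M"
    if "odd n" "maximal_matching G M" for M
  proof -
    have m: "matching G M" using that by (simp add: maximal_matching_def)
    show ?thesis
      using card_unmatched[OF G m] m assms(3) \<open>odd n\<close>
      unfolding near_perfect_matching_def by presburger
  qed
  have even_case: "(\<forall>M. maximal_matching G M \<longrightarrow> card M = n div 2) \<longleftrightarrow>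
      graph_iso G (complete_graph n) \<or> graph_iso G (complete_bipartite_graph (n div 2) (n div 2))"
    if "even n"
  proof
    assume all: "\<forall>M. maximal_matching G M \<longrightarrow> card M = n div 2"
    have "\<Union>M = verts G" if "maximal_matching G M" for M
    proof -
      have m: "matching G M" using that by (simp add: maximal_matching_def)
      \<comment> \<open>For even \<open>n\<close>, a matching with \<open>n div 2\<close> edges
        covers all \<open>n\<close> vertices.\<close>
      have "card (\<Union>M) = card (verts G)"
        using all that card_Union_matching[OF G m] \<open>even n\<close> assms(3) by simp
      then show ?thesis using Union_matching_subset[OF G m] fin by (metis card_subset_eq)
    qed
    with randomly_matchable_complete_or_bipartite[OF G assms(2)] have
      "(\<forall>u\<in>verts G. \<forall>v\<in>verts G. adj G u v \<longleftrightarrow> u \<noteq> v) \<or>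
      (\<exists>X\<subseteq>verts G. card (verts G - X) = card X \<and>
        (\<forall>u\<in>verts G. \<forall>v\<in>verts G. adj G u v \<longleftrightarrow> (u \<in> X) \<noteq> (v \<in> X)))"
      by blast
    then show "graph_iso G (complete_graph n) \<or> graph_iso G (complete_bipartite_graph (n div 2) (n div 2))"
    proof (elim disjE exE conjE)
      fix X assume X: "X \<subseteq> verts G" "card (verts G - X) = card X"
        "\<forall>u\<in>verts G. \<forall>v\<in>verts G. adj G u v \<longleftrightarrow> (u \<in> X) \<noteq> (v \<in> X)"
      have "card X = n div 2"
        using X fin assms(3) card_Diff_subset[of X "verts G"] card_mono[of "verts G" X]
          finite_subset[of X "verts G"] by auto
      then have "graph_iso G (complete_bipartite_graph (n div 2) (n div 2))"
        unfolding graph_iso_complete_bipartite_graph_iff[OF fin] using X by auto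
      then show ?thesis ..
    qed (simp add: graph_iso_complete_graph_iff[OF fin assms(3)])
  next
    assume "graph_iso G (complete_graph n) \<or> graph_iso G (complete_bipartite_graph (n div 2) (n div 2))"
    then have "2 * card M = n" if "maximal_matching G M" for M
    proof
      assume "graph_iso G (complete_graph n)"
      then show ?thesis
        using complete_maximal_matching_perfect[OF G _ _ that] \<open>even n\<close> assms(3)
        by (simp add: graph_iso_complete_graph_iff[OF fin assms(3)])
    next
      assume "graph_iso G (complete_bipartite_graph (n div 2) (n div 2))"
      then show ?thesis
        using balanced_complete_bipartite_maximal_matching_perfect[OF G _ _ _ that] assms(3)
        unfolding graph_iso_complete_bipartite_graph_iff[OF fin] by metis
    qed
    then show "\<forall>M. maximal_matching G M \<longrightarrow> card M = n div 2" by fastforce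
  qed
  show ?thesis using bound eq odd_case even_case by blast
qed

end
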